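(* Let $V_n$ be an $n$-dimensional linear space of functions $u:[0,1]\to\mathbb{R}$, let $f_1,\ldots,f_n$ be basis functions of $V_n$, and let $f=(f_1,\ldots,f_n)^T$. Let $l\in\mathcal{S}_{V_n}$ be an element of the affine fractel semigroup of $V_n$. Then: (1) there exists a matrix $M_l\in\mathbb{R}^{n\times n}$ such that $f\circ l=M_l f$; (2) if $l^*(V_n)=V_n$, then $M_l$ is invertible.
   Context: $\mathcal{S}=\{l : l(x)=\sigma x+\tau,\ l([0,1])\subset[0,1]\}$ is the set of affine maps leaving $[0,1]$ invariant. The (affine) fractel semigroup of $V_n$ is $\mathcal{S}_{V_n}=\{l\in\mathcal{S} : u\circ l\in V_n\text{ for all }u\in V_n\}$. For $l\in\mathcal{S}_{V_n}$, $l^*$ denotes the pullback $l^*(u)=u\circ l$, and $l^*(V_n)=\{u\circ l : u\in V_n\}$. *)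

theory Defs
  imports "HOL-Analysis.Analysis" "HOL-Library.Function_Algebras"
begin

instantiation "fun" :: (type, real_vector) real_vector
begin

definition scaleR_fun_def: "scaleR r u = (\<lambda>x. scaleR r (u x))"

instance
  by standard (simp_all add: scaleR_fun_def fun_eq_iff scaleR_add_left scaleR_add_right)

end

typedef unit_interval = "{0..1::real}"
  by force

definition affine_self_maps :: "(real \<Rightarrow> real) set" where
  "affine_self_maps = {l. (\<exists>\<sigma> \<tau>. \<forall>x. l x = \<sigma> * x + \<tau>) \<and> l ` {0..1} \<subseteq> {0..1}}"

text \<open>Composition of a function on \<open>[0,1]\<close> with a map \<open>l\<close> of the real line; it is
  meaningful only if \<open>l\<close> maps \<open>[0,1]\<close> into itself, because \<^const>\<open>Abs_unit_interval\<close> is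
  unspecified outside \<open>[0,1]\<close>.\<close>

definition comp_unit :: "(unit_interval \<Rightarrow> 'a) \<Rightarrow> (real \<Rightarrow> real) \<Rightarrow> unit_interval \<Rightarrow> 'a" where
  "comp_unit u l = (\<lambda>x. u (Abs_unit_interval (l (Rep_unit_interval x))))"

definition fractel_semigroup :: "(unit_interval \<Rightarrow> real) set \<Rightarrow> (real \<Rightarrow> real) set" where
  "fractel_semigroup V = {l \<in> affine_self_maps. \<forall>u\<in>V. comp_unit u l \<in> V}"

definition pullback :: "(real \<Rightarrow> real) \<Rightarrow> (unit_interval \<Rightarrow> real) \<Rightarrow> (unit_interval \<Rightarrow> real)" where
  "pullback l u = comp_unit u l"

definition stack :: "('n \<Rightarrow> unit_interval \<Rightarrow> real) \<Rightarrow> unit_interval \<Rightarrow> real ^ 'n::finite" where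
  "stack f = (\<lambda>x. \<chi> i. f i x)"

definition is_basis_of :: "('n \<Rightarrow> 'v::real_vector) \<Rightarrow> 'v set \<Rightarrow> bool" where
  "is_basis_of f V \<longleftrightarrow> inj f \<and> independent (range f) \<and> span (range f) = V"

end

theory Submission
  imports Defs
begin

text \<open>Since \<open>l\<close> belongs to the fractel semigroup, every f_i o l lies in V, and
  its coordinates in the basis f form row i of M. If the pullback is onto, pick g_i in V with g_i o
  l = f_i and write g = N f. Then f = g o l = N (f o l) = N M f, and uniqueness of coordinates
  forces N M = 1, so the square matrix M is invertible. The two halves of the coordinate argument,
  existence and uniqueness for a whole family at once, are \<open>is_basis_of_matrix_exists\<close>
  and \<open>is_basis_of_matrix_unique\<close>.\<close>

lemma sum_fun_apply: "sum F A x = (\<Sum>i\<in>A. F i x)" for F :: "'i \<Rightarrow> 'a \<Rightarrow> 'b::comm_monoid_add"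
  by (induction A rule: infinite_finite_induct) simp_all

lemma pullback_stack: "stack (\<lambda>i. pullback l (f i)) = comp_unit (stack f) l"
  by (simp add: stack_def pullback_def comp_unit_def)

text \<open>Passes from a matrix acting on values at a point to linear combinations in the function
  space, where span and independence apply.\<close>

lemma matrix_vector_mult_stack:
  fixes M :: "real ^ 'n::finite ^ 'm::finite"
  shows "M *v stack f x = stack (\<lambda>i. \<Sum>j\<in>UNIV. M $ i $ j *\<^sub>R f j) x"
  by (simp add: vec_eq_iff matrix_vector_mult_def stack_def sum_fun_apply scaleR_fun_def)

lemma stack_eq_iff: "stack g = stack h \<longleftrightarrow> g = h"
  by (auto simp: stack_def fun_eq_iff vec_eq_iff)

text \<open>Row i of M consists of the coordinates of \<open>g i\<close>. It serves twice: for the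
  pulled-back basis, giving M, and for preimages of the basis, giving N.\<close>

lemma is_basis_of_matrix_exists:
  fixes f :: "'n::finite \<Rightarrow> unit_interval \<Rightarrow> real" and g :: "'m::finite \<Rightarrow> unit_interval \<Rightarrow> real"
  assumes "is_basis_of f V" and "\<And>i. g i \<in> V"
  obtains M :: "real ^ 'n ^ 'm" where "stack g = (\<lambda>x. M *v stack f x)"
proof -
  have inj: "inj f" and span: "span (range f) = V"
    using assms(1) by (auto simp: is_basis_of_def)
  have "\<exists>c. g i = (\<Sum>j\<in>UNIV. c j *\<^sub>R f j)" for i
  proof -
    have "g i \<in> range (\<lambda>u. \<Sum>v\<in>range f. u v *\<^sub>R v)"
      using assms(2) span by (simp flip: span_finite)
    then obtain u where "g i = (\<Sum>v\<in>range f. u v *\<^sub>R v)" by blast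
    then have "g i = (\<Sum>j\<in>UNIV. u (f j) *\<^sub>R f j)"
      by (simp add: sum.reindex[OF inj])
    then show ?thesis by (rule exI[of _ "\<lambda>j. u (f j)"])
  qed
  then obtain c where "\<And>i. g i = (\<Sum>j\<in>UNIV. c i j *\<^sub>R f j)" by metis
  then have "g = (\<lambda>i. \<Sum>j\<in>UNIV. c i j *\<^sub>R f j)" by (rule ext)
  then have "stack g = (\<lambda>x. (\<chi> i j. c i j) *v stack f x)"
    by (simp add: matrix_vector_mult_stack)
  then show thesis by (rule that)
qed

text \<open>Each row of A - B is a linear relation among the basis functions, hence zero by
  independence.\<close>

lemma is_basis_of_matrix_unique:
  fixes f :: "'n::finite \<Rightarrow> unit_interval \<Rightarrow> real" and A B :: "real ^ 'n ^ 'm::finite"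
  assumes "is_basis_of f V" and "\<And>x. A *v stack f x = B *v stack f x"
  shows "A = B"
proof -
  have inj: "inj f" and indep: "independent (range f)"
    using assms(1) by (auto simp: is_basis_of_def)
  have "stack (\<lambda>i. \<Sum>j\<in>UNIV. A $ i $ j *\<^sub>R f j) = stack (\<lambda>i. \<Sum>j\<in>UNIV. B $ i $ j *\<^sub>R f j)"
    using assms(2) by (simp add: matrix_vector_mult_stack ext)
  then have AB: "(\<lambda>i. \<Sum>j\<in>UNIV. A $ i $ j *\<^sub>R f j) = (\<lambda>i. \<Sum>j\<in>UNIV. B $ i $ j *\<^sub>R f j)"
    by (simp only: stack_eq_iff)
  have "A $ i $ j = B $ i $ j" for i j
  proof -
    \<comment> \<open>\<open>independentD\<close> takes coefficients indexed by vectors rather than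
      by indices; \<open>inv f\<close> translates, as \<open>f\<close> is injective.\<close>
    define u where "u v = A $ i $ inv f v - B $ i $ inv f v" for v
    have "(\<Sum>v\<in>range f. u v *\<^sub>R v) = (\<Sum>j\<in>UNIV. (A $ i $ j - B $ i $ j) *\<^sub>R f j)"
      by (simp add: sum.reindex[OF inj] u_def inv_f_f[OF inj])
    also have "\<dots> = (\<Sum>j\<in>UNIV. A $ i $ j *\<^sub>R f j) - (\<Sum>j\<in>UNIV. B $ i $ j *\<^sub>R f j)"
      by (simp add: scaleR_diff_left sum_subtractf)
    also have "\<dots> = 0"
      using AB by (simp add: fun_eq_iff[of "\<lambda>i. \<Sum>j\<in>UNIV. A $ i $ j *\<^sub>R f j"])
    finally have "u (f j) = 0"
      using independentD[OF indep _ order_refl] by auto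
    then show ?thesis by (simp add: u_def inv_f_f[OF inj])
  qed
  then show ?thesis by (simp add: vec_eq_iff)
qed

theorem proposition6p1:
  fixes V :: "(unit_interval \<Rightarrow> real) set"
    and f :: "'n::finite \<Rightarrow> unit_interval \<Rightarrow> real"
    and l :: "real \<Rightarrow> real"
  assumes "subspace V"
    and "dim V = CARD('n)"
    and "is_basis_of f V"
    and "l \<in> fractel_semigroup V"
  shows "(\<exists>M :: real ^ 'n ^ 'n. comp_unit (stack f) l = (\<lambda>x. M *v stack f x)) \<and>
    (pullback l ` V = V \<longrightarrow>
      (\<forall>M :: real ^ 'n ^ 'n. comp_unit (stack f) l = (\<lambda>x. M *v stack f x) \<longrightarrow> invertible M))"
proof (intro conjI impI allI)
  have fV: "f i \<in> V" for i
    using assms(3) span_base[of "f i" "range f"] by (auto simp: is_basis_of_def)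
  then have "pullback l (f i) \<in> V" for i
    using assms(4) by (simp add: fractel_semigroup_def pullback_def)
  then obtain M :: "real ^ 'n ^ 'n" where "stack (\<lambda>i. pullback l (f i)) = (\<lambda>x. M *v stack f x)"
    using is_basis_of_matrix_exists[OF assms(3)] by metis
  then show "\<exists>M :: real ^ 'n ^ 'n. comp_unit (stack f) l = (\<lambda>x. M *v stack f x)"
    by (auto simp: pullback_stack)

  fix M :: "real ^ 'n ^ 'n"
  assume onto: "pullback l ` V = V" and M: "comp_unit (stack f) l = (\<lambda>x. M *v stack f x)"
  have "\<exists>u\<in>V. f i = pullback l u" for i
    using fV[of i] onto by blast
  then obtain g where gV: "\<And>i. g i \<in> V" and g: "\<And>i. f i = pullback l (g i)" by metis
  obtain N :: "real ^ 'n ^ 'n" where N: "stack g = (\<lambda>x. N *v stack f x)"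
    using is_basis_of_matrix_exists[OF assms(3) gV] .
  have "(N ** M) *v stack f x = mat 1 *v stack f x" for x
  proof -
    have "(N ** M) *v stack f x = N *v comp_unit (stack f) l x"
      by (simp add: M matrix_vector_mul_assoc)
    \<comment> \<open>The identity g = N f holds at every point, in particular at the image of
      \<open>x\<close> under \<open>l\<close>.\<close>
    also have "\<dots> = comp_unit (stack g) l x"
      by (simp add: comp_unit_def N)
    also have "\<dots> = stack f x"
      by (simp flip: pullback_stack g)
    finally show ?thesis by simp
  qed
  then have "N ** M = mat 1"
    by (rule is_basis_of_matrix_unique[OF assms(3)])
  \<comment> \<open>M is square, so a left inverse suffices.\<close>
  then show "invertible M"
    using invertible_left_inverse by blast
qed

end
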